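(* Let $m\ge k\ge 0$ be integers and let $C=(c_1,\ldots,c_{2^k})$ be a cycle, of length $2^k$, of the permutation $Q_m$ of $\mathbb{Z}/2^m\mathbb{Z}$, and suppose that $C$ has an ever-doubling period. Then the restriction of $Q$ to $B(c_1,2^{-m})\cup\cdots\cup B(c_{2^k},2^{-m})$ is ergodic.
   Context: The $3x+1$ map $T:\mathbb{Z}_2\to\mathbb{Z}_2$ is $T(x)=\frac{3x+1}{2}$ if $x$ is odd, $T(x)=\frac x2$ if $x$ is even. For $x\in\mathbb{Z}_2$, the parity sequence of $x$ is $(s_0,s_1,s_2,\ldots)$ with $s_k\in\{0,1\}$, $s_k\equiv T^k(x)\pmod 2$, and $Q:\mathbb{Z}_2\to\mathbb{Z}_2$ is $Q(x)=\sum_{k=0}^\infty s_k2^k$. It is known that $Q$ is a bijective 2-adic isometry preserving the Haar measure $\mu$ (normalized by $\mu(\mathbb{Z}_2)=1$). For $n\ge0$, $Q_n:\mathbb{Z}/2^n\mathbb{Z}\to\mathbb{Z}/2^n\mathbb{Z}$, $x\mapsto Q(x)\bmod 2^n$, is the induced permutation. Elements of $\mathbb{Z}/2^n\mathbb{Z}$ are identified with integers in $\{0,\ldots,2^n-1\}$. A cycle $C=(c_1,\ldots,c_{2^k})$ of $Q_m$ of length $2^k$ is said to have an ever-doubling period if, for all $n\ge m$, the elements $c_1,\ldots,c_{2^k}$ are all included in a single cycle of $Q_n$ of length $2^{n-m+k}$. $B(y,2^{-m})=\{x\in\mathbb{Z}_2: x\equiv y \pmod{2^m}\}$. Ergodicity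 is with respect to the restriction of $\mu$ to the ($Q$-invariant) set in question: every measurable $Q$-invariant subset has measure zero or full measure. *)

theory Defs
  imports "HOL-Probability.Probability"
begin

text \<open>The ring of 2-adic integers as the inverse limit of the rings Z/2^n: an element is the sequence
  of its residues modulo 2^n, each represented in {0..<2^n}.\<close>

typedef two_adic = "{x :: nat \<Rightarrow> int. \<forall>n. x n = x (Suc n) mod 2 ^ n}"
  morphisms mod_pow2 Abs_two_adic
  by (rule exI[of _ "\<lambda>_. 0"]) simp

setup_lifting type_definition_two_adic

lemma two_adic_eqI: "(\<And>n. mod_pow2 x n = mod_pow2 y n) \<Longrightarrow> x = y"
  by (rule mod_pow2_inject[THEN iffD1], rule ext)

lemma mod_pow2_Suc: "mod_pow2 x (Suc n) mod 2 ^ n = mod_pow2 x n"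
proof -
  have "\<forall>n. mod_pow2 x n = mod_pow2 x (Suc n) mod 2 ^ n"
    using mod_pow2[of x] by (rule CollectD)
  then have "mod_pow2 x n = mod_pow2 x (Suc n) mod 2 ^ n" ..
  then show ?thesis ..
qed

lemma mod_pow2_mod_le: "m \<le> n \<Longrightarrow> mod_pow2 x n mod 2 ^ m = mod_pow2 x m"
proof (induction n rule: dec_induct)
  case base
  have "mod_pow2 x (Suc m) mod 2 ^ m mod 2 ^ m = mod_pow2 x (Suc m) mod 2 ^ m"
    by (rule mod_mod_trivial)
  then show ?case unfolding mod_pow2_Suc .
next
  case (step n)
  have "mod_pow2 x (Suc n) mod 2 ^ m = (mod_pow2 x (Suc n) mod 2 ^ n) mod 2 ^ m"
    using step.hyps by (simp add: mod_mod_cancel le_imp_power_dvd)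
  then show ?case using step.IH mod_pow2_Suc by simp
qed

lemma mod_pow2_mod [simp]: "mod_pow2 x n mod 2 ^ n = mod_pow2 x n"
  by (simp add: mod_pow2_mod_le)

lemma mod_pow2_bounds: "0 \<le> mod_pow2 x n" "mod_pow2 x n < 2 ^ n"
  using pos_mod_sign[of "2 ^ n" "mod_pow2 x n"] pos_mod_bound[of "2 ^ n" "mod_pow2 x n"]
  by simp_all

lemma mod_pow2_0 [simp]: "mod_pow2 x 0 = 0"
  using mod_pow2_bounds[of x 0] by simp

lemma mod_Suc_mod: "(a :: int) mod 2 ^ Suc n mod 2 ^ n = a mod 2 ^ n"
  by (rule mod_mod_cancel) simp

lemma two_adic_closed:
  fixes x y :: "nat \<Rightarrow> int"
  assumes x: "\<And>n. x n = x (Suc n) mod 2 ^ n" and y: "\<And>n. y n = y (Suc n) mod 2 ^ n"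
    and f: "\<And>a b m. f (a mod m) (b mod m) mod m = f a b mod m"
  shows "f (x n) (y n) mod 2 ^ n = f (x (Suc n)) (y (Suc n)) mod 2 ^ Suc n mod 2 ^ n"
proof -
  have "f (x n) (y n) mod 2 ^ n = f (x (Suc n) mod 2 ^ n) (y (Suc n) mod 2 ^ n) mod 2 ^ n"
    by (rule arg_cong2[OF x y])
  also have "\<dots> = f (x (Suc n)) (y (Suc n)) mod 2 ^ n" by (rule f)
  finally show "f (x n) (y n) mod 2 ^ n = f (x (Suc n)) (y (Suc n)) mod 2 ^ Suc n mod 2 ^ n"
    unfolding mod_Suc_mod .
qed

instantiation two_adic :: comm_ring_1
begin

lift_definition zero_two_adic :: two_adic is "\<lambda>n. 0" by simp

lift_definition one_two_adic :: two_adic is "\<lambda>n. 1 mod 2 ^ n"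
  by (simp only: mod_Suc_mod simp_thms)

lift_definition plus_two_adic :: "two_adic \<Rightarrow> two_adic \<Rightarrow> two_adic"
  is "\<lambda>x y n. (x n + y n) mod 2 ^ n"
  by (rule two_adic_closed[where f = "(+)", OF _ _ mod_add_eq])

lift_definition minus_two_adic :: "two_adic \<Rightarrow> two_adic \<Rightarrow> two_adic"
  is "\<lambda>x y n. (x n - y n) mod 2 ^ n"
  by (rule two_adic_closed[where f = "(-)", OF _ _ mod_diff_eq])

lift_definition uminus_two_adic :: "two_adic \<Rightarrow> two_adic"
  is "\<lambda>x n. (- x n) mod 2 ^ n"
  by (rule two_adic_closed[where f = "\<lambda>a b. - a", OF _ _ mod_minus_eq])

lift_definition times_two_adic :: "two_adic \<Rightarrow> two_adic \<Rightarrow> two_adic"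
  is "\<lambda>x y n. (x n * y n) mod 2 ^ n"
  by (rule two_adic_closed[where f = "(*)", OF _ _ mod_mult_eq])

instance
proof
  fix a b c :: two_adic
  show "a * b * c = a * (b * c)"
    by (rule two_adic_eqI) (simp add: times_two_adic.rep_eq mod_simps mult.assoc)
  show "a * b = b * a"
    by (rule two_adic_eqI) (simp add: times_two_adic.rep_eq mult.commute)
  show "1 * a = a"
    by (rule two_adic_eqI) (simp add: times_two_adic.rep_eq one_two_adic.rep_eq mod_simps)
  show "a + b + c = a + (b + c)"
    by (rule two_adic_eqI) (simp add: plus_two_adic.rep_eq mod_simps add.assoc)
  show "a + b = b + a"
    by (rule two_adic_eqI) (simp add: plus_two_adic.rep_eq add.commute)
  show "0 + a = a"
    by (rule two_adic_eqI) (simp add: plus_two_adic.rep_eq zero_two_adic.rep_eq)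
  show "- a + a = 0"
    by (rule two_adic_eqI)
      (simp add: plus_two_adic.rep_eq uminus_two_adic.rep_eq zero_two_adic.rep_eq mod_simps)
  show "a - b = a + - b"
    by (rule two_adic_eqI)
      (simp add: plus_two_adic.rep_eq uminus_two_adic.rep_eq minus_two_adic.rep_eq mod_simps)
  show "(a + b) * c = a * c + b * c"
    by (rule two_adic_eqI)
      (simp add: plus_two_adic.rep_eq times_two_adic.rep_eq mod_simps algebra_simps)
  have "mod_pow2 0 1 \<noteq> mod_pow2 1 1"
    by (simp add: zero_two_adic.rep_eq one_two_adic.rep_eq)
  then show "(0 :: two_adic) \<noteq> 1" by metis
qed

end

lemma mod_pow2_of_nat: "mod_pow2 (of_nat a) n = int a mod 2 ^ n"
  by (induction a)
     (simp_all add: zero_two_adic.rep_eq plus_two_adic.rep_eq one_two_adic.rep_eq mod_simps)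

lemma mod_pow2_power: "mod_pow2 (x ^ k) n = mod_pow2 x n ^ k mod 2 ^ n"
  by (induction k)
     (simp_all add: times_two_adic.rep_eq one_two_adic.rep_eq mod_simps)

lemma mod_pow2_two_power: "mod_pow2 (2 ^ k) n = 2 ^ k mod 2 ^ n"
  using mod_pow2_of_nat[of "2 ^ k" n] by simp

lemma pow2_dvd_iff: "2 ^ n dvd x \<longleftrightarrow> mod_pow2 x n = 0"
proof
  assume "2 ^ n dvd x"
  then obtain y where "x = 2 ^ n * y" by (elim dvdE)
  then show "mod_pow2 x n = 0"
    by (simp add: times_two_adic.rep_eq mod_pow2_two_power)
next
  assume x0: "mod_pow2 x n = 0"
  define y where "y = (\<lambda>k. mod_pow2 x (n + k) div 2 ^ n)"
  have "y k = y (Suc k) mod 2 ^ k" for k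
  proof -
    define a where "a = mod_pow2 x (Suc (n + k))"
    have "mod_pow2 x (n + k) = a mod (2 ^ n * 2 ^ k)"
      using mod_pow2_Suc[of x "n + k"] by (simp add: a_def power_add)
    also have "\<dots> = 2 ^ n * (a div 2 ^ n mod 2 ^ k) + a mod 2 ^ n"
      by (rule zmod_zmult2_eq) simp
    finally show ?thesis
      by (simp add: y_def a_def)
  qed
  then have rep: "mod_pow2 (Abs_two_adic y) = y"
    by (intro Abs_two_adic_inverse CollectI allI)
  have "x = 2 ^ n * Abs_two_adic y"
  proof (rule two_adic_eqI)
    fix k
    have "mod_pow2 x (n + k) mod 2 ^ n = 0"
      using mod_pow2_mod_le[of n "n + k" x] x0 by simp
    then have "2 ^ n * y k = mod_pow2 x (n + k)"
      unfolding y_def by auto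
    then show "mod_pow2 x k = mod_pow2 (2 ^ n * Abs_two_adic y) k"
      using mod_pow2_mod_le[of k "n + k" x]
      by (simp add: times_two_adic.rep_eq mod_pow2_two_power rep mod_simps)
  qed
  then show "2 ^ n dvd x" by simp
qed

lemma mod_pow2_diff_eq_0_iff: "mod_pow2 (x - y) n = 0 \<longleftrightarrow> mod_pow2 x n = mod_pow2 y n"
  by (simp add: minus_two_adic.rep_eq)
     (metis mod_eq_0_iff_dvd mod_eq_dvd_iff mod_pow2_mod)

lemma pow2_dvd_diff_iff: "2 ^ n dvd x - y \<longleftrightarrow> mod_pow2 x n = mod_pow2 y n"
  by (simp add: pow2_dvd_iff mod_pow2_diff_eq_0_iff)

lemma mod_pow2_eq_mono: "mod_pow2 x n = mod_pow2 y n \<Longrightarrow> m \<le> n \<Longrightarrow> mod_pow2 x m = mod_pow2 y m"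
  by (metis mod_pow2_mod_le)

instantiation two_adic :: metric_space
begin

definition dist_two_adic :: "two_adic \<Rightarrow> two_adic \<Rightarrow> real" where
  "dist (x :: two_adic) y = (if x = y then 0 else (1 / 2) ^ Max {n. 2 ^ n dvd x - y})"

definition uniformity_two_adic :: "(two_adic \<times> two_adic) filter" where
  "uniformity_two_adic = (INF e\<in>{0<..}. principal {(x, y). dist x y < e})"

definition open_two_adic :: "two_adic set \<Rightarrow> bool" where
  "open_two_adic U = (\<forall>x\<in>U. eventually (\<lambda>(x', y). x' = x \<longrightarrow> y \<in> U) uniformity)"

lemma dist_two_adic_le_iff: "dist x y \<le> (1 / 2) ^ n \<longleftrightarrow> mod_pow2 x n = mod_pow2 y n"
  for x y :: two_adic
proof (cases "x = y")
  case True
  then show ?thesis by (simp add: dist_two_adic_def)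
next
  case False
  define S where "S = {n. mod_pow2 x n = mod_pow2 y n}"
  obtain l where l: "mod_pow2 x l \<noteq> mod_pow2 y l"
    using False two_adic_eqI by blast
  have "S \<subseteq> {..<l}"
  proof
    fix i assume "i \<in> S"
    then have "\<not> l \<le> i"
      using l mod_pow2_eq_mono[of x i y l] unfolding S_def by blast
    then show "i \<in> {..<l}" by simp
  qed
  then have fin: "finite S" by (rule finite_subset) simp
  have "0 \<in> S" by (simp add: S_def)
  then have ne: "S \<noteq> {}" by blast
  have "n \<le> Max S \<longleftrightarrow> n \<in> S"
  proof
    assume "n \<le> Max S"
    moreover have "mod_pow2 x (Max S) = mod_pow2 y (Max S)"
      using Max_in[OF fin ne] unfolding S_def by blast
    ultimately show "n \<in> S" unfolding S_def using mod_pow2_eq_mono by blast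
  qed (rule Max_ge[OF fin])
  moreover have "dist x y = (1 / 2) ^ Max S"
    using False by (simp add: dist_two_adic_def S_def pow2_dvd_diff_iff)
  moreover have "((1 / 2 :: real) ^ Max S \<le> (1 / 2) ^ n) \<longleftrightarrow> n \<le> Max S"
    by (simp add: power_decreasing_iff)
  ultimately show ?thesis by (simp add: S_def)
qed

lemma dist_two_adic_ultra: "dist x y \<le> max (dist x z) (dist y z)"
  for x y z :: two_adic
proof -
  have *: "\<exists>n. dist a b = (1 / 2) ^ n" if "a \<noteq> b" for a b :: two_adic
    using that by (auto simp: dist_two_adic_def)
  have nn: "0 \<le> dist a b" for a b :: two_adic by (simp add: dist_two_adic_def)
  show ?thesis
  proof (cases "x = z \<or> y = z")
    case True
    then show ?thesis
    proof
      assume "x = z"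
      moreover have "dist z y = dist y z"
        by (simp only: dist_two_adic_def pow2_dvd_diff_iff eq_commute[of z y]
            eq_commute[of "mod_pow2 z _" "mod_pow2 y _"])
      ultimately show ?thesis by simp
    qed simp
  next
    case False
    obtain n where n: "max (dist x z) (dist y z) = (1 / 2) ^ n"
      using False *[of x z] *[of y z] by (cases "dist x z \<le> dist y z") (auto simp: max_def)
    then have "dist x z \<le> (1 / 2) ^ n" "dist y z \<le> (1 / 2) ^ n" by linarith+
    then show ?thesis unfolding n by (simp add: dist_two_adic_le_iff)
  qed
qed

instance
proof
  fix x y z :: two_adic
  show "dist x y = 0 \<longleftrightarrow> x = y" by (simp add: dist_two_adic_def)
  have nn: "0 \<le> dist a b" for a b :: two_adic by (simp add: dist_two_adic_def)
  show "dist x y \<le> dist x z + dist y z"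
    using dist_two_adic_ultra[of x y z] nn[of x z] nn[of y z] by linarith
qed (rule uniformity_two_adic_def open_two_adic_def)+

end

definition adic_ball :: "two_adic \<Rightarrow> nat \<Rightarrow> two_adic set" where
  "adic_ball y m = {x. 2 ^ m dvd x - y}"

lemma adic_ball_eq_cball: "adic_ball y m = cball y ((1 / 2) ^ m)"
  by (auto simp: adic_ball_def pow2_dvd_diff_iff dist_two_adic_le_iff)

lemma adic_ball_altdef: "adic_ball y m = {x. mod_pow2 x m = mod_pow2 y m}"
  by (simp add: adic_ball_def pow2_dvd_diff_iff)

text \<open>The quotients exist and are unique; see \<open>collatz_T_even\<close> and \<open>collatz_T_odd\<close> below.\<close>

definition collatz_T :: "two_adic \<Rightarrow> two_adic" where
  "collatz_T x = (if 2 dvd x then THE y. 2 * y = x else THE y. 2 * y = 3 * x + 1)"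

definition parity_seq :: "two_adic \<Rightarrow> nat \<Rightarrow> nat" where
  "parity_seq x k = (if 2 dvd (collatz_T ^^ k) x then 0 else 1)"

text \<open>The series converges in the 2-adic metric; see \<open>Q_sums\<close> below.\<close>

definition Q :: "two_adic \<Rightarrow> two_adic" where
  "Q x = (\<Sum>k. of_nat (parity_seq x k) * 2 ^ k)"

definition Q_mod :: "nat \<Rightarrow> nat \<Rightarrow> nat" where
  "Q_mod n a = nat (mod_pow2 (Q (of_nat a)) n)"

lemma two_adic_mult_2_cancel: "2 * y = 2 * z \<Longrightarrow> y = z" for y z :: two_adic
proof (rule two_adic_eqI)
  fix n
  assume "2 * y = 2 * z"
  then have "mod_pow2 (2 * y) (Suc n) = mod_pow2 (2 * z) (Suc n)" by simp
  then have "2 * mod_pow2 y (Suc n) mod 2 ^ Suc n = 2 * mod_pow2 z (Suc n) mod 2 ^ Suc n"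
    using mod_pow2_two_power[of 1 "Suc n"] by (simp add: times_two_adic.rep_eq mod_simps del: power_Suc)
  then have "mod_pow2 y (Suc n) mod 2 ^ n = mod_pow2 z (Suc n) mod 2 ^ n"
    by (simp add: mult_mod_right[symmetric])
  then show "mod_pow2 y n = mod_pow2 z n" by (simp add: mod_pow2_Suc)
qed

lemma two_dvd_iff: "2 dvd x \<longleftrightarrow> mod_pow2 x 1 = 0"
  using pow2_dvd_iff[of 1 x] by simp

lemma collatz_T_even: "2 dvd x \<Longrightarrow> 2 * collatz_T x = x"
proof -
  assume "2 dvd x"
  then obtain y where "2 * y = x" by (metis dvdE)
  then have "(THE y. 2 * y = x) = y" using two_adic_mult_2_cancel by blast
  with \<open>2 dvd x\<close> \<open>2 * y = x\<close> show ?thesis by (simp add: collatz_T_def)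
qed

lemma collatz_T_odd: "\<not> 2 dvd x \<Longrightarrow> 2 * collatz_T x = 3 * x + 1"
proof -
  assume odd: "\<not> 2 dvd x"
  have "mod_pow2 x 1 = 1"
    using mod_pow2_bounds[of x 1] odd two_dvd_iff[of x] by simp
  then have "2 dvd x + 1"
    by (simp add: two_dvd_iff plus_two_adic.rep_eq one_two_adic.rep_eq)
  then have "2 dvd 2 * x + (x + 1)" by (metis dvd_add dvd_triv_left)
  also have "2 * x + (x + 1) = 3 * x + 1" by (simp add: algebra_simps)
  finally obtain y where "2 * y = 3 * x + 1" by (metis dvdE)
  moreover from this have "(THE y. 2 * y = 3 * x + 1) = y"
    by (metis (mono_tags, lifting) the_equality two_adic_mult_2_cancel)
  ultimately show ?thesis using odd by (simp add: collatz_T_def)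
qed

lemma mod_pow2_sum: "mod_pow2 (\<Sum>i\<in>A. f i) n = (\<Sum>i\<in>A. mod_pow2 (f i) n) mod 2 ^ n"
  by (induction A rule: infinite_finite_induct)
     (simp_all add: zero_two_adic.rep_eq plus_two_adic.rep_eq mod_simps)

lemma two_adic_tendstoI:
  assumes "\<And>n m. n \<le> m \<Longrightarrow> mod_pow2 (f m) n = mod_pow2 x n"
  shows "f \<longlonglongrightarrow> x"
proof (rule metric_LIMSEQ_I)
  fix e :: real assume "0 < e"
  then obtain n where n: "(1 / 2) ^ n < e" using real_arch_pow_inv[of e "1 / 2"] by auto
  show "\<exists>no. \<forall>m\<ge>no. dist (f m) x < e"
    using assms n dist_two_adic_le_iff by (metis le_less_trans)
qed

lemma sums_digits:
  fixes d :: "nat \<Rightarrow> nat"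
  shows "\<exists>x. (\<lambda>k. of_nat (d k) * 2 ^ k) sums x \<and>
             (\<forall>n. mod_pow2 x n = (\<Sum>k<n. int (d k) * 2 ^ k) mod 2 ^ n)"
proof -
  define s where "s = (\<lambda>n. \<Sum>k<n. int (d k) * 2 ^ k)"
  have s: "s m mod 2 ^ n = s n mod 2 ^ n" if "n \<le> m" for n m
    using that
  proof (induction m rule: dec_induct)
    case (step m)
    have "(2 :: int) ^ n dvd int (d m) * 2 ^ m"
      using step.hyps by (simp add: le_imp_power_dvd)
    then have "s (Suc m) mod 2 ^ n = s m mod 2 ^ n"
      unfolding s_def by (simp add: mod_add_right_eq[symmetric] del: mod_add_right_eq)
    then show ?case using step.IH by simp
  qed simp
  have "\<forall>n. s n mod 2 ^ n = s (Suc n) mod 2 ^ Suc n mod 2 ^ n"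
    unfolding mod_Suc_mod by (intro allI s[symmetric]) simp
  then have rep: "mod_pow2 (Abs_two_adic (\<lambda>n. s n mod 2 ^ n)) = (\<lambda>n. s n mod 2 ^ n)"
    by (intro Abs_two_adic_inverse CollectI)
  have part: "(\<Sum>k<m. of_nat (d k) * 2 ^ k) = (of_nat (\<Sum>k<m. d k * 2 ^ k) :: two_adic)" for m
    by simp
  have "(\<lambda>m. \<Sum>k<m. of_nat (d k) * 2 ^ k) \<longlonglongrightarrow> Abs_two_adic (\<lambda>n. s n mod 2 ^ n)"
    unfolding part
  proof (rule two_adic_tendstoI)
    fix n m :: nat assume "n \<le> m"
    then show "mod_pow2 (of_nat (\<Sum>k<m. d k * 2 ^ k)) n = mod_pow2 (Abs_two_adic (\<lambda>n. s n mod 2 ^ n)) n"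
      using s[of n m] by (simp only: mod_pow2_of_nat rep) (simp add: s_def)
  qed
  then show ?thesis
    unfolding sums_def
    by (intro exI[of _ "Abs_two_adic (\<lambda>n. s n mod 2 ^ n)"] conjI) (simp_all add: rep, simp add: s_def)
qed

lemma Q_sums: "(\<lambda>k. of_nat (parity_seq x k) * 2 ^ k) sums Q x"
  unfolding Q_def using sums_digits[of "parity_seq x"] by (metis sums_unique)

lemma mod_pow2_Q: "mod_pow2 (Q x) n = (\<Sum>k<n. int (parity_seq x k) * 2 ^ k) mod 2 ^ n"
  using sums_digits[of "parity_seq x"] Q_sums[of x] by (metis sums_unique2)

definition normalized_haar :: "two_adic measure \<Rightarrow> bool" where
  "normalized_haar M \<longleftrightarrow>
     sets M = sets borel \<and> (\<forall>a. distr M M (\<lambda>x. a + x) = M) \<and> emeasure M (space M) = 1"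

lemma adic_ball_open: "open (adic_ball y n)"
  unfolding open_dist
proof (intro ballI exI conjI allI impI)
  fix x z :: two_adic
  assume x: "x \<in> adic_ball y n" and z: "dist z x < (1 / 2) ^ n"
  then have "mod_pow2 z n = mod_pow2 x n" by (simp flip: dist_two_adic_le_iff)
  with x show "z \<in> adic_ball y n" by (simp add: adic_ball_altdef)
qed simp

lemma adic_ball_borel [measurable]: "adic_ball y n \<in> sets borel"
  using adic_ball_open by simp

lemma adic_ball_center_of_nat: "adic_ball y n = adic_ball (of_nat (nat (mod_pow2 y n))) n"
  unfolding adic_ball_altdef mod_pow2_of_nat using mod_pow2_bounds[of y n] by simp

lemma countable_adic_balls: "countable {adic_ball y n | y n. True}"
proof -
  have "{adic_ball y n | y n. True} \<subseteq> (\<lambda>(r, n). adic_ball (of_nat r) n) ` UNIV"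
  proof
    fix A assume "A \<in> {adic_ball y n | y n. True}"
    then obtain y n where "A = adic_ball y n" by blast
    then have "A = (\<lambda>(r, n). adic_ball (of_nat r) n) (nat (mod_pow2 y n), n)"
      using adic_ball_center_of_nat[of y n] by (simp only: prod.case)
    then show "A \<in> (\<lambda>(r, n). adic_ball (of_nat r) n) ` UNIV" by (rule image_eqI) simp
  qed
  then show ?thesis by (rule countable_subset) simp
qed

lemma open_eq_Union_adic_balls:
  assumes "open U"
  shows "U = \<Union> {A \<in> {adic_ball y n | y n. True}. A \<subseteq> U}"
proof -
  have *: "\<exists>n. adic_ball x n \<subseteq> U" if x: "x \<in> U" for x
  proof -
    obtain e where e: "0 < e" "cball x e \<subseteq> U"
      using assms x open_contains_cball by blast
    then obtain n where "(1 / 2) ^ n < e" using real_arch_pow_inv[of e "1 / 2"] by auto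
    then have "adic_ball x n \<subseteq> cball x e" by (auto simp: adic_ball_eq_cball)
    then show ?thesis using e(2) by blast
  qed
  have **: "x \<in> adic_ball x n" for x n by (simp add: adic_ball_altdef)
  show ?thesis
  proof (intro equalityI subsetI)
    fix x assume "x \<in> U"
    then obtain n where "adic_ball x n \<subseteq> U" using * by blast
    then show "x \<in> \<Union> {A \<in> {adic_ball y n | y n. True}. A \<subseteq> U}"
      using ** by (intro UnionI[of "adic_ball x n"]) auto
  qed (auto dest: subsetD)
qed

lemma borel_eq_sigma_adic_balls:
  "sets (borel :: two_adic measure) = sigma_sets UNIV {adic_ball y n | y n. True}"
proof
  have "U \<in> sigma_sets UNIV {adic_ball y n | y n. True}" if "open U" for U :: "two_adic set"
  proof -
    have "\<Union> {A \<in> {adic_ball y n | y n. True}. A \<subseteq> U} \<in> sigma_sets UNIV {adic_ball y n | y n. True}"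
    proof (rule sigma_sets_UNION)
      show "countable {A \<in> {adic_ball y n | y n. True}. A \<subseteq> U}"
        by (rule countable_subset[OF _ countable_adic_balls]) blast
    qed (blast intro: sigma_sets.Basic)
    then show ?thesis by (simp only: open_eq_Union_adic_balls[OF that, symmetric])
  qed
  then have "sigma_sets UNIV {U. open U} \<subseteq> sigma_sets UNIV {adic_ball y n | y n. True}"
    by (intro sigma_sets_mono subsetI) (simp only: mem_Collect_eq)
  then show "sets (borel :: two_adic measure) \<subseteq> sigma_sets UNIV {adic_ball y n | y n. True}"
    by (simp only: borel_def sets_measure_of subset_UNIV Pow_UNIV)
  show "sigma_sets UNIV {adic_ball y n | y n. True} \<subseteq> sets (borel :: two_adic measure)"
  proof -
    have "{adic_ball y n | y n. True} \<subseteq> sets borel" by (auto intro: adic_ball_borel)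
    from sets.sigma_sets_subset[OF this] show ?thesis by (simp only: space_borel)
  qed
qed

lemma adic_ball_Int:
  "adic_ball x n \<inter> adic_ball y m \<in> {adic_ball y n | y n. True} \<union> {{}}"
proof (cases "adic_ball x n \<inter> adic_ball y m = {}")
  case False
  then obtain z where z: "z \<in> adic_ball x n" "z \<in> adic_ball y m" by blast
  have "adic_ball x n \<inter> adic_ball y m = adic_ball z (max n m)"
  proof (rule set_eqI)
    fix w
    have "mod_pow2 w (max n m) = mod_pow2 z (max n m) \<longleftrightarrow>
          mod_pow2 w n = mod_pow2 z n \<and> mod_pow2 w m = mod_pow2 z m"
      using mod_pow2_eq_mono[of w "max n m" z n] mod_pow2_eq_mono[of w "max n m" z m]
      by (cases "n \<le> m") (auto simp: max_def)
    then show "w \<in> adic_ball x n \<inter> adic_ball y m \<longleftrightarrow> w \<in> adic_ball z (max n m)"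
      using z by (simp add: adic_ball_altdef)
  qed
  then show ?thesis by blast
qed simp

lemma two_adic_measure_eqI:
  assumes M: "sets M = sets (borel :: two_adic measure)" and N: "sets N = sets (borel :: two_adic measure)"
    and eq: "\<And>y n. emeasure M (adic_ball y n) = emeasure N (adic_ball y n)"
    and fin: "emeasure M UNIV \<noteq> \<infinity>"
  shows "M = N"
proof (rule measure_eqI_generator_eq[where A = "\<lambda>_. UNIV" and \<Omega> = UNIV
      and E = "{adic_ball y n | y n. True} \<union> {{}}"])
  have "sigma_sets UNIV ({adic_ball y n | y n. True} \<union> {{}}) = sets (borel :: two_adic measure)"
    unfolding borel_eq_sigma_adic_balls
    by (intro equalityI sigma_sets_mono) (auto intro: sigma_sets.Basic sigma_sets.Empty)
  then show "sets M = sigma_sets UNIV ({adic_ball y n | y n. True} \<union> {{}})"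
    "sets N = sigma_sets UNIV ({adic_ball y n | y n. True} \<union> {{}})"
    using M N by auto
  show "Int_stable ({adic_ball y n | y n. True} \<union> {{}})"
  proof (rule Int_stableI)
    fix X Y assume X: "X \<in> {adic_ball y n | y n. True} \<union> {{}}"
      and Y: "Y \<in> {adic_ball y n | y n. True} \<union> {{}}"
    show "X \<inter> Y \<in> {adic_ball y n | y n. True} \<union> {{}}"
    proof (cases "X = {} \<or> Y = {}")
      case False
      then obtain x n y m where "X = adic_ball x n" "Y = adic_ball y m" using X Y by blast
      then show ?thesis using adic_ball_Int[of x n y m] by (simp only:)
    qed auto
  qed
  have "mod_pow2 x 0 = 0" for x
    by simp
  then have "UNIV = adic_ball 0 0"
    by (auto simp: adic_ball_altdef)
  then show "range (\<lambda>_::nat. UNIV) \<subseteq> {adic_ball y n | y n. True} \<union> {{}}" by blast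
qed (use eq fin in auto)

lemma adic_ball_translate: "(\<lambda>x. a + x) -` adic_ball y n = adic_ball (y - a) n"
  by (auto simp: adic_ball_def algebra_simps)

lemma translate_measurable [measurable]: "(\<lambda>x. a + x) \<in> borel \<rightarrow>\<^sub>M (borel :: two_adic measure)"
proof (rule measurable_sigma_sets[OF borel_eq_sigma_adic_balls])
  fix A :: "two_adic set" assume "A \<in> {adic_ball y n | y n. True}"
  then show "(\<lambda>x. a + x) -` A \<inter> space borel \<in> sets borel"
    by (auto simp: adic_ball_translate)
qed auto

lemma adic_balls_disjoint: "disjoint_family_on (\<lambda>r. adic_ball (of_nat r) n) {..<2 ^ n :: nat}"
  unfolding disjoint_family_on_def
proof (intro ballI impI)
  fix r s :: nat assume "r \<in> {..<2 ^ n}" "s \<in> {..<2 ^ n}" "r \<noteq> s"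
  then have "int r < 2 ^ n" "int s < 2 ^ n" by simp_all
  then have "int r mod 2 ^ n = int r" "int s mod 2 ^ n = int s" by simp_all
  with \<open>r \<noteq> s\<close> show "adic_ball (of_nat r) n \<inter> adic_ball (of_nat s) n = {}"
    unfolding adic_ball_altdef mod_pow2_of_nat by auto
qed

lemma adic_balls_cover: "(\<Union>r\<in>{..<2 ^ n :: nat}. adic_ball (of_nat r) n) = UNIV"
proof -
  have "x \<in> adic_ball (of_nat (nat (mod_pow2 x n))) n" for x
    using mod_pow2_bounds[of x n] unfolding adic_ball_altdef mod_pow2_of_nat by simp
  moreover have "nat (mod_pow2 x n) < 2 ^ n" for x
    using mod_pow2_bounds[of x n] by (simp add: nat_less_iff)
  ultimately show ?thesis by blast
qed

lemma sum_measure_adic_balls: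
  assumes "prob_space M" and sM: "sets M = sets (borel :: two_adic measure)"
  shows "(\<Sum>r\<in>{..<2 ^ n :: nat}. measure M (adic_ball (of_nat r) n)) = 1"
proof -
  interpret prob_space M by fact
  have sp: "space M = UNIV" using sets_eq_imp_space_eq[OF sM] by simp
  have "(\<Sum>r\<in>{..<2 ^ n :: nat}. measure M (adic_ball (of_nat r) n)) =
      measure M (\<Union>r\<in>{..<2 ^ n :: nat}. adic_ball (of_nat r) n)"
    using adic_balls_disjoint
    by (intro finite_measure_finite_Union[symmetric]) (auto simp: sM adic_ball_borel)
  then show ?thesis using prob_space by (simp add: adic_balls_cover sp)
qed

lemma emeasure_adic_ball_eqI:
  assumes sM: "sets M = sets (borel :: two_adic measure)" and one: "emeasure M (space M) = 1"
    and eq: "\<And>y z. emeasure M (adic_ball y n) = emeasure M (adic_ball z n)"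
  shows "emeasure M (adic_ball y n) = ennreal ((1 / 2) ^ n)"
proof -
  have M: "prob_space M" using one by (rule prob_spaceI)
  interpret prob_space M by fact
  have "(\<Sum>r\<in>{..<2 ^ n :: nat}. measure M (adic_ball (of_nat r) n)) =
      (\<Sum>r\<in>{..<2 ^ n :: nat}. measure M (adic_ball y n))"
    by (rule sum.cong[OF refl]) (unfold measure_def, rule arg_cong[where f = enn2real], rule eq)
  then have "2 ^ n * measure M (adic_ball y n) = 1"
    using sum_measure_adic_balls[OF M sM, of n] by simp
  then have "measure M (adic_ball y n) = (1 / 2) ^ n"
    by (simp add: field_simps)
  then show ?thesis by (simp only: emeasure_eq_measure)
qed

lemma normalized_haar_emeasure_adic_ball:
  assumes "normalized_haar M"
  shows "emeasure M (adic_ball y n) = ennreal ((1 / 2) ^ n)"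
proof (rule emeasure_adic_ball_eqI)
  show sM: "sets M = sets borel" and "emeasure M (space M) = 1"
    using assms by (auto simp: normalized_haar_def)
  fix y z :: two_adic
  have [measurable_cong]: "sets M = sets borel" by (fact sM)
  have "space M = UNIV" using sets_eq_imp_space_eq[OF sM] by simp
  have "emeasure M (adic_ball y n) = emeasure (distr M M (\<lambda>x. (y - z) + x)) (adic_ball y n)"
    using assms by (simp add: normalized_haar_def)
  also have "\<dots> = emeasure M ((\<lambda>x. (y - z) + x) -` adic_ball y n \<inter> space M)"
    by (rule emeasure_distr) measurable
  also have "\<dots> = emeasure M (adic_ball z n)"
    by (simp add: adic_ball_translate \<open>space M = UNIV\<close>)
  finally show "emeasure M (adic_ball y n) = emeasure M (adic_ball z n)" .
qed

lemma normalized_haarI: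
  assumes sM: "sets M = sets borel" and M: "\<And>y n. emeasure M (adic_ball y n) = ennreal ((1 / 2) ^ n)"
  shows "normalized_haar M"
proof -
  have [measurable_cong]: "sets M = sets borel" by (fact sM)
  have sp: "space M = UNIV" using sets_eq_imp_space_eq[OF sM] by simp
  have "adic_ball 0 0 = UNIV" by (auto simp: adic_ball_altdef)
  then have one: "emeasure M UNIV = 1" using M[of 0 0] by simp
  have "distr M M (\<lambda>x. a + x) = M" for a
  proof (rule two_adic_measure_eqI)
    show e: "emeasure (distr M M (\<lambda>x. a + x)) (adic_ball y n) = emeasure M (adic_ball y n)" for y n
      by (subst emeasure_distr) (simp_all add: sM adic_ball_translate sp M)
    show "emeasure (distr M M (\<lambda>x. a + x)) UNIV \<noteq> \<infinity>"
      using e[of 0 0] \<open>adic_ball 0 0 = UNIV\<close> one by simp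
  qed (simp_all add: sM)
  then show ?thesis using sM one by (simp add: normalized_haar_def sp)
qed

lemma ex_normalized_haar: "\<exists>M. normalized_haar M"
proof -
  define P where "P = (\<Pi>\<^sub>M i\<in>(UNIV :: nat set). measure_pmf (pmf_of_set {0, 1 :: nat}))"
  interpret P: product_prob_space "\<lambda>_ :: nat. measure_pmf (pmf_of_set {0, 1 :: nat})" UNIV ..
  interpret PP: prob_space P unfolding P_def by (intro prob_space_PiM measure_pmf.prob_space_axioms)
  define \<Phi> where "\<Phi> = (\<lambda>d :: nat \<Rightarrow> nat. (\<Sum>k. of_nat (d k) * 2 ^ k) :: two_adic)"
  have \<Phi>: "mod_pow2 (\<Phi> d) n = (\<Sum>k<n. int (d k) * 2 ^ k) mod 2 ^ n" for d n
    unfolding \<Phi>_def using sums_digits[of d] by (metis sums_unique)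
  have spP: "space P = UNIV" by (simp add: P_def space_PiM)
  have mball: "\<Phi> -` adic_ball y n \<in> sets P" for y n
  proof -
    have [measurable]: "(\<lambda>d. \<Sum>k<n. int (d k) * 2 ^ k) \<in> P \<rightarrow>\<^sub>M count_space UNIV"
    proof (induction n)
      case (Suc n)
      have "(\<lambda>d. d n) \<in> P \<rightarrow>\<^sub>M measure_pmf (pmf_of_set {0, 1 :: nat})"
        unfolding P_def by (rule measurable_component_singleton) simp
      then have [measurable]: "(\<lambda>d. d n) \<in> P \<rightarrow>\<^sub>M count_space UNIV" by simp
      note Suc.IH [measurable]
      show ?case by simp
    qed simp
    have "\<Phi> -` adic_ball y n = {d \<in> space P. (\<Sum>k<n. int (d k) * 2 ^ k) mod 2 ^ n = mod_pow2 y n}"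
      by (auto simp: adic_ball_altdef \<Phi> spP)
    also have "\<dots> \<in> sets P" by measurable
    finally show ?thesis .
  qed
  have [measurable]: "\<Phi> \<in> P \<rightarrow>\<^sub>M borel"
    by (rule measurable_sigma_sets[OF borel_eq_sigma_adic_balls]) (use mball spP in auto)
  have cyl: "\<exists>d. (\<forall>k<n. d k \<in> {0, 1 :: nat}) \<and> mod_pow2 y n = (\<Sum>k<n. int (d k) * 2 ^ k)" for y n
  proof (induction n)
    case 0
    then show ?case using mod_pow2_bounds[of y 0] by simp
  next
    case (Suc n)
    then obtain d where d: "\<forall>k<n. d k \<in> {0, 1 :: nat}" "mod_pow2 y n = (\<Sum>k<n. int (d k) * 2 ^ k)" by auto
    define q where "q = mod_pow2 y (Suc n) div 2 ^ n"
    have v: "mod_pow2 y (Suc n) = q * 2 ^ n + mod_pow2 y n"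
      using div_mult_mod_eq[of "mod_pow2 y (Suc n)" "2 ^ n"] unfolding q_def mod_pow2_Suc by simp
    have "q = 0 \<or> q = 1"
    proof -
      have "0 \<le> q" unfolding q_def using mod_pow2_bounds[of y "Suc n"] by (simp add: pos_imp_zdiv_nonneg_iff)
      moreover have "q < 2"
      proof -
        have "q * 2 ^ n < 2 * 2 ^ n"
          using v mod_pow2_bounds(2)[of y "Suc n"] mod_pow2_bounds(1)[of y n]
          unfolding power_Suc by linarith
        then show ?thesis by (simp only: mult_less_cancel_right_pos zero_less_power zero_less_numeral)
      qed
      ultimately show ?thesis by linarith
    qed
    then show ?case using d v by (intro exI[of _ "d(n := nat q)"]) auto
  qed
  have lower: "emeasure (distr P borel \<Phi>) (adic_ball y n) \<ge> ennreal ((1 / 2) ^ n)" for y n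
  proof -
    obtain d where d: "\<forall>k<n. d k \<in> {0, 1 :: nat}" "mod_pow2 y n = (\<Sum>k<n. int (d k) * 2 ^ k)"
      using cyl by blast
    define E where "E = prod_emb UNIV (\<lambda>_ :: nat. measure_pmf (pmf_of_set {0, 1 :: nat})) {..<n} (\<Pi>\<^sub>E k\<in>{..<n}. {d k})"
    have "emeasure P E = (\<Prod>k<n. emeasure (measure_pmf (pmf_of_set {0, 1 :: nat})) {d k})"
      unfolding E_def P_def by (rule P.emeasure_PiM_emb) auto
    also have "\<dots> = (\<Prod>k<n. ennreal (1 / 2))"
      using d(1) by (intro prod.cong refl) (auto simp: emeasure_pmf_single)
    also have "\<dots> = ennreal ((1 / 2) ^ n)"
      by (subst prod_ennreal) simp_all
    finally have E: "emeasure P E = ennreal ((1 / 2) ^ n)" .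
    have "E \<subseteq> \<Phi> -` adic_ball y n"
    proof
      fix e assume "e \<in> E"
      then have "e k = d k" if "k < n" for k
        using that by (auto simp: E_def prod_emb_def PiE_iff)
      then have "mod_pow2 (\<Phi> e) n = mod_pow2 y n mod 2 ^ n"
        unfolding \<Phi> d(2) by simp
      then show "e \<in> \<Phi> -` adic_ball y n" by (simp add: adic_ball_altdef)
    qed
    then have "emeasure P E \<le> emeasure P (\<Phi> -` adic_ball y n \<inter> space P)"
      using mball by (intro emeasure_mono) (auto simp: spP)
    also have "\<dots> = emeasure (distr P borel \<Phi>) (adic_ball y n)"
      by (rule emeasure_distr[symmetric]) measurable
    finally show ?thesis unfolding E .
  qed
  define N where "N = distr P borel \<Phi>"
  interpret N: prob_space N unfolding N_def by (rule PP.prob_space_distr) simp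
  have "emeasure N (adic_ball y n) = ennreal ((1 / 2) ^ n)" for y n
  proof (rule antisym)
    define r0 where "r0 = nat (mod_pow2 y n)"
    have r0: "r0 < 2 ^ n" "adic_ball y n = adic_ball (of_nat r0) n"
      using mod_pow2_bounds[of y n] unfolding r0_def
      by (simp add: nat_less_iff) (rule adic_ball_center_of_nat)
    have "(1 / 2) ^ n \<le> measure N (adic_ball z n)" for z
      using lower[of n z] by (simp add: N_def[symmetric] N.emeasure_eq_measure)
    then have "(\<Sum>r\<in>{..<2 ^ n :: nat} - {r0}. (1 / 2) ^ n) \<le> (\<Sum>r\<in>{..<2 ^ n :: nat} - {r0}. measure N (adic_ball (of_nat r) n))"
      by (intro sum_mono) auto
    moreover have "(\<Sum>r\<in>{..<2 ^ n :: nat} - {r0}. (1 / 2 :: real) ^ n) = 1 - (1 / 2) ^ n"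
      using r0(1) by (simp add: of_nat_diff field_simps)
    moreover have "(\<Sum>r\<in>{..<2 ^ n :: nat}. measure N (adic_ball (of_nat r) n)) = 1"
      by (rule sum_measure_adic_balls) (unfold_locales, simp add: N_def)
    moreover have "(\<Sum>r\<in>{..<2 ^ n :: nat}. measure N (adic_ball (of_nat r) n)) =
        measure N (adic_ball (of_nat r0) n) + (\<Sum>r\<in>{..<2 ^ n :: nat} - {r0}. measure N (adic_ball (of_nat r) n))"
      using r0(1) by (intro sum.remove) auto
    ultimately have "measure N (adic_ball y n) \<le> (1 / 2) ^ n"
      unfolding r0(2) by linarith
    then show "emeasure N (adic_ball y n) \<le> ennreal ((1 / 2) ^ n)"
      by (simp add: N.emeasure_eq_measure)
  qed (use lower in \<open>simp add: N_def\<close>)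
  then have "normalized_haar N" by (intro normalized_haarI) (simp_all add: N_def)
  then show ?thesis by blast
qed

lemma normalized_haar_unique:
  assumes "normalized_haar M" "normalized_haar N"
  shows "M = N"
proof (rule two_adic_measure_eqI)
  show sM: "sets M = sets borel" and "sets N = sets borel"
    using assms by (simp_all add: normalized_haar_def)
  have "space M = UNIV" using sets_eq_imp_space_eq[OF sM] by simp
  then show "emeasure M UNIV \<noteq> \<infinity>" using assms(1) by (simp add: normalized_haar_def)
qed (simp add: assms normalized_haar_emeasure_adic_ball)

definition haar :: "two_adic measure" where
  "haar = (THE M. normalized_haar M)"

lemma normalized_haar_haar: "normalized_haar haar"
  unfolding haar_def using ex_normalized_haar normalized_haar_unique by (metis theI)

text \<open>An ergodic map is in particular a measure-preserving self-map of the space of \<open>M\<close>. For a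
  restricted space this includes that the restricting set is mapped into itself.\<close>

definition ergodic :: "'a measure \<Rightarrow> ('a \<Rightarrow> 'a) \<Rightarrow> bool" where
  "ergodic M f \<longleftrightarrow>
     f \<in> M \<rightarrow>\<^sub>M M \<and> distr M M f = M \<and>
     (\<forall>E\<in>sets M. f -` E \<inter> space M = E \<longrightarrow> emeasure M E = 0 \<or> emeasure M (space M - E) = 0)"

definition is_cycle :: "('a \<Rightarrow> 'a) \<Rightarrow> 'a set \<Rightarrow> 'a list \<Rightarrow> bool" where
  "is_cycle f S cs \<longleftrightarrow>
     cs \<noteq> [] \<and> distinct cs \<and> set cs \<subseteq> S \<and>
     (\<forall>i<length cs. f (cs ! i) = cs ! (Suc i mod length cs))"

text \<open>The entries of \<open>C\<close>, which represent residues modulo \<open>2 ^ m\<close>, are read as residues modulo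
  \<open>2 ^ n\<close> through their representatives in \<open>{..<2 ^ m}\<close>.\<close>

definition ever_doubling_period :: "nat \<Rightarrow> nat \<Rightarrow> nat list \<Rightarrow> bool" where
  "ever_doubling_period m k C \<longleftrightarrow>
     (\<forall>n\<ge>m. \<exists>D. is_cycle (Q_mod n) {..<2 ^ n} D \<and> length D = 2 ^ (n - m + k) \<and> set C \<subseteq> set D)"

end

theory Submission
  imports Defs
begin

text \<open>\<open>Q\<close> is an isometry, so it permutes the balls of each radius and preserves the Haar measure.
  By counting, the cycle of \<open>Q_mod n\<close> that contains \<open>C\<close> consists of all residues modulo \<open>2 ^ n\<close> lying
  over \<open>C\<close>. Hence an invariant subset \<open>E\<close> of the union \<open>X\<close> of the balls meets all balls of radius
  \<open>2 ^ -n\<close> in \<open>X\<close> in the same measure. So \<open>A \<mapsto> \<mu> X * \<mu> (E \<inter> A)\<close> and \<open>A \<mapsto> \<mu> E * \<mu> (X \<inter> A)\<close> agree on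
  balls, therefore on all Borel sets, and \<open>A = X - E\<close> gives \<open>\<mu> E * \<mu> (X - E) = 0\<close>.\<close>

section \<open>The isometry property\<close>

lemma pow2_Suc_dvd_double_iff: "2 ^ Suc n dvd 2 * x \<longleftrightarrow> 2 ^ n dvd x" for x :: two_adic
proof
  assume "2 ^ Suc n dvd 2 * x"
  then obtain z where "2 * x = 2 * (2 ^ n * z)" by (auto elim!: dvdE simp: mult.assoc)
  then show "2 ^ n dvd x" using two_adic_mult_2_cancel by (metis dvd_triv_left)
qed (simp add: mult_dvd_mono)

text \<open>3 is a unit modulo \<open>2 ^ n\<close>, so the odd branch of \<open>collatz_T\<close>
  distorts 2-adic distances exactly as the even branch does.\<close>

lemma pow2_dvd_triple_iff: "2 ^ n dvd 3 * x \<longleftrightarrow> 2 ^ n dvd x" for x :: two_adic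
proof
  assume "2 ^ n dvd 3 * x"
  then have "(2 ^ n :: int) dvd 3 * mod_pow2 x n"
    using mod_pow2_of_nat[of 3 n]
    by (simp add: pow2_dvd_iff times_two_adic.rep_eq mod_mult_left_eq mod_eq_0_iff_dvd[symmetric])
  moreover have "coprime (2 ^ n :: int) 3" by simp
  ultimately have "(2 ^ n :: int) dvd mod_pow2 x n" by (simp add: coprime_dvd_mult_right_iff)
  then show "2 ^ n dvd x" by (metis mod_eq_0_iff_dvd mod_pow2_mod pow2_dvd_iff)
qed (rule dvd_mult)

text \<open>For \<open>x\<close> and \<open>y\<close> of equal parity,
  \<open>2 * (collatz_T x - collatz_T y)\<close> is \<open>x - y\<close> or
  \<open>3 * (x - y)\<close>; for different parities, \<open>x - y\<close> is odd. This is the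
  induction step that trades one binary digit for one parity.\<close>

lemma pow2_Suc_dvd_diff_iff_collatz_T:
  "2 ^ Suc n dvd x - y \<longleftrightarrow> (2 dvd x \<longleftrightarrow> 2 dvd y) \<and> 2 ^ n dvd collatz_T x - collatz_T y"
proof (cases "2 dvd x \<longleftrightarrow> 2 dvd y")
  case False
  have "\<not> 2 ^ Suc n dvd x - y"
  proof
    assume "2 ^ Suc n dvd x - y"
    then have "2 dvd x - y" by (metis dvd_mult_left power_Suc)
    then show False using False
      by (metis diff_add_cancel dvd_add dvd_add_right_iff)
  qed
  then show ?thesis using False by simp
next
  case True
  have "2 ^ n dvd collatz_T x - collatz_T y \<longleftrightarrow> 2 ^ Suc n dvd 2 * (collatz_T x - collatz_T y)"
    by (simp only: pow2_Suc_dvd_double_iff)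
  also have "\<dots> \<longleftrightarrow> 2 ^ Suc n dvd x - y"
  proof (cases "2 dvd x")
    case even: True
    then have "2 * (collatz_T x - collatz_T y) = x - y"
      using True by (simp add: right_diff_distrib collatz_T_even)
    then show ?thesis by (simp only:)
  next
    case odd: False
    then have "2 * (collatz_T x - collatz_T y) = 3 * (x - y)"
      using True by (simp add: right_diff_distrib collatz_T_odd)
    then show ?thesis by (simp only: pow2_dvd_triple_iff)
  qed
  finally show ?thesis using True by simp
qed

lemma parity_seq_Suc: "parity_seq x (Suc k) = parity_seq (collatz_T x) k"
  by (simp add: parity_seq_def funpow_swap1)

lemma pow2_dvd_diff_iff_parity_seq:
  "2 ^ n dvd x - y \<longleftrightarrow> (\<forall>k<n. parity_seq x k = parity_seq y k)"
proof (induction n arbitrary: x y)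
  case (Suc n)
  have "(2 dvd x \<longleftrightarrow> 2 dvd y) \<longleftrightarrow> parity_seq x 0 = parity_seq y 0"
    by (simp add: parity_seq_def)
  then show ?case
    unfolding pow2_Suc_dvd_diff_iff_collatz_T Suc.IH All_less_Suc2 parity_seq_Suc by simp
qed simp

lemma binary_digits_sum_less:
  fixes d :: "nat \<Rightarrow> nat"
  assumes "\<And>k. d k \<le> 1"
  shows "(\<Sum>k<n. int (d k) * 2 ^ k) < 2 ^ n"
proof (induction n)
  case (Suc n)
  have "int (d n) * 2 ^ n \<le> 1 * 2 ^ n" using assms[of n] by (intro mult_right_mono) auto
  then show ?case using Suc unfolding sum.lessThan_Suc power_Suc by linarith
qed simp

text \<open>The digits below position \<open>n\<close> sum to a value in \<open>{0..<2 ^ n}\<close>,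
  so dividing by \<open>2 ^ n\<close> isolates the top digit.\<close>

lemma binary_digits_sum_eq_iff:
  fixes d e :: "nat \<Rightarrow> nat"
  assumes d: "\<And>k. d k \<le> 1" and e: "\<And>k. e k \<le> 1"
  shows "(\<Sum>k<n. int (d k) * 2 ^ k) = (\<Sum>k<n. int (e k) * 2 ^ k) \<longleftrightarrow> (\<forall>k<n. d k = e k)"
proof (induction n)
  case (Suc n)
  have "d n = e n" if eq: "(\<Sum>k<Suc n. int (d k) * 2 ^ k) = (\<Sum>k<Suc n. int (e k) * 2 ^ k)"
  proof -
    have "0 \<le> (\<Sum>k<n. int (f k) * 2 ^ k)" for f :: "nat \<Rightarrow> nat" by (simp add: sum_nonneg)
    then have "(\<Sum>k<Suc n. int (f k) * 2 ^ k) div 2 ^ n = int (f n)" if "\<And>k. f k \<le> 1"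
      for f :: "nat \<Rightarrow> nat"
      using binary_digits_sum_less[of f n] that by (simp add: div_pos_pos_trivial)
    then show ?thesis using eq d e by (metis of_nat_eq_iff)
  qed
  then show ?case using Suc by (auto simp: less_Suc_eq)
qed simp

text \<open>The first \<open>n\<close> binary digits of \<open>Q x\<close> are the first
  \<open>n\<close> parities of \<open>x\<close>, and these correspond bijectively to the residue of
  \<open>x\<close> modulo \<open>2 ^ n\<close>. With \<open>dist_two_adic_le_iff\<close> this says
  that \<open>Q\<close> is an isometry.\<close>

lemma mod_pow2_Q_eq_iff: "mod_pow2 (Q x) n = mod_pow2 (Q y) n \<longleftrightarrow> mod_pow2 x n = mod_pow2 y n"
proof -
  have le: "parity_seq z k \<le> 1" for z k by (simp add: parity_seq_def)
  then have "mod_pow2 (Q z) n = (\<Sum>k<n. int (parity_seq z k) * 2 ^ k)" for z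
    unfolding mod_pow2_Q by (intro mod_pos_pos_trivial sum_nonneg binary_digits_sum_less) auto
  then show ?thesis
    by (simp add: binary_digits_sum_eq_iff[OF le le] pow2_dvd_diff_iff_parity_seq
        flip: pow2_dvd_diff_iff)
qed

section \<open>The induced permutations\<close>

text \<open>A natural-number version of \<open>mod_pow2\<close>, since \<open>Q_mod\<close> and the
  cycles live on \<open>nat\<close>.\<close>

definition residue :: "nat \<Rightarrow> two_adic \<Rightarrow> nat" where
  "residue n x = nat (mod_pow2 x n)"

lemma residue_less: "residue n x < 2 ^ n"
  using mod_pow2_bounds[of x n] by (simp add: residue_def nat_less_iff)

lemma int_residue: "int (residue n x) = mod_pow2 x n"
  by (simp add: residue_def mod_pow2_bounds)

lemma residue_of_nat: "residue n (of_nat a) = a mod 2 ^ n"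
  by (simp add: residue_def mod_pow2_of_nat nat_mod_distrib nat_power_eq)

lemma residue_mod: "m \<le> n \<Longrightarrow> residue n x mod 2 ^ m = residue m x"
  using mod_pow2_mod_le[of m n x] by (simp add: zmod_int int_residue flip: of_nat_eq_iff[where 'a = int])

lemma residue_eq_iff: "residue n x = residue n y \<longleftrightarrow> mod_pow2 x n = mod_pow2 y n"
  by (simp flip: int_residue)

lemma mem_adic_ball_iff_residue: "x \<in> adic_ball y n \<longleftrightarrow> residue n x = residue n y"
  by (simp add: adic_ball_altdef residue_eq_iff)

text \<open>\<open>Q_mod\<close> evaluates \<open>Q\<close> at one particular representative; by the
  isometry property any other representative gives the same residue.\<close>

lemma residue_Q: "residue n (Q x) = Q_mod n (residue n x)"
proof -
  have "residue n x = residue n (of_nat (residue n x))"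
    by (simp add: residue_of_nat residue_less)
  then have "residue n (Q x) = residue n (Q (of_nat (residue n x)))"
    by (simp add: residue_eq_iff mod_pow2_Q_eq_iff)
  then show ?thesis by (simp add: Q_mod_def residue_def)
qed

lemma Q_mod_less: "Q_mod n a < 2 ^ n"
  using residue_less[of n "Q (of_nat a)"] by (simp add: Q_mod_def residue_def)

lemma Q_mod_mod:
  assumes "m \<le> n"
  shows "Q_mod n a mod 2 ^ m = Q_mod m (a mod 2 ^ m)"
proof -
  have "Q_mod n a mod 2 ^ m = residue m (Q (of_nat a))"
    using residue_mod[OF assms, of "Q (of_nat a)"] by (simp add: Q_mod_def residue_def)
  then show ?thesis by (simp add: residue_Q residue_of_nat)
qed

lemma inj_on_Q_mod: "inj_on (Q_mod n) {..<2 ^ n}"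
proof (rule inj_onI)
  fix a b :: nat
  assume ab: "a \<in> {..<2 ^ n}" "b \<in> {..<2 ^ n}" "Q_mod n a = Q_mod n b"
  then have "residue n (Q (of_nat a)) = residue n (Q (of_nat b))"
    by (simp add: residue_def Q_mod_def)
  then have "residue n (of_nat a) = residue n (of_nat b)"
    by (simp add: residue_eq_iff mod_pow2_Q_eq_iff)
  then show "a = b" using ab by (simp add: residue_of_nat)
qed

lemma Q_mod_surj: "r < 2 ^ n \<Longrightarrow> \<exists>a<2 ^ n. Q_mod n a = r"
proof -
  have "Q_mod n ` {..<2 ^ n} = {..<2 ^ n}"
    using Q_mod_less by (intro endo_inj_surj inj_on_Q_mod) auto
  then show "r < 2 ^ n \<Longrightarrow> \<exists>a<2 ^ n. Q_mod n a = r" by (metis imageE lessThan_iff)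
qed

lemma Q_vimage_adic_ball: "Q -` adic_ball (Q y) n = adic_ball y n"
  by (auto simp: adic_ball_altdef mod_pow2_Q_eq_iff)

text \<open>A ball depends only on the residue of its centre, and surjectivity of the finite map
  \<open>Q_mod n\<close> supplies a centre of the form \<open>Q (of_nat a)\<close>.\<close>

lemma ex_Q_vimage_adic_ball: "\<exists>z. Q -` adic_ball y n = adic_ball z n"
proof -
  obtain a where "Q_mod n a = residue n y" using Q_mod_surj residue_less by blast
  then have "residue n (Q (of_nat a)) = residue n y" by (simp add: Q_mod_def residue_def)
  then have "adic_ball y n = adic_ball (Q (of_nat a)) n" by (simp add: set_eq_iff mem_adic_ball_iff_residue)
  then show ?thesis using Q_vimage_adic_ball by blast
qed

section \<open>Cycles\<close>

lemma is_cycle_apply_mem: "is_cycle f S cs \<Longrightarrow> x \<in> set cs \<Longrightarrow> f x \<in> set cs"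
proof -
  assume cyc: "is_cycle f S cs" and "x \<in> set cs"
  then obtain i where i: "i < length cs" "x = cs ! i" by (auto simp: in_set_conv_nth)
  then have "f x = cs ! (Suc i mod length cs)" using cyc by (simp add: is_cycle_def)
  moreover have "Suc i mod length cs < length cs" using i(1) by (intro mod_less_divisor) linarith
  ultimately show "f x \<in> set cs" by simp
qed

text \<open>The finite counterpart of ergodicity. It is applied to the property of lying over
  \<open>C\<close> and to the measure of the part of a set in a ball.\<close>

lemma is_cycle_constant:
  assumes cyc: "is_cycle f S cs" and g: "\<And>x. x \<in> set cs \<Longrightarrow> g (f x) = g x"
    and x: "x \<in> set cs" and y: "y \<in> set cs"
  shows "g x = g y"
proof -
  have "g (cs ! i) = g (cs ! 0)" if "i < length cs" for i
    using that
  proof (induction i)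
    case (Suc i)
    then have "f (cs ! i) = cs ! Suc i" using cyc by (simp add: is_cycle_def)
    then show ?case using Suc g[of "cs ! i"] by simp
  qed simp
  then show ?thesis using x y by (metis in_set_conv_nth)
qed

text \<open>An injective map sending the finite set of cycle entries into itself sends it onto
  itself, so no point of \<open>S\<close> outside the cycle can enter it.\<close>

lemma is_cycle_apply_mem_iff:
  assumes cyc: "is_cycle f S cs" and inj: "inj_on f S" and x: "x \<in> S"
  shows "f x \<in> set cs \<longleftrightarrow> x \<in> set cs"
proof
  assume "f x \<in> set cs"
  have sub: "set cs \<subseteq> S" using cyc by (simp add: is_cycle_def)
  have "f ` set cs = set cs"
    using is_cycle_apply_mem[OF cyc] inj_on_subset[OF inj sub] by (intro endo_inj_surj) auto
  then obtain y where "y \<in> set cs" "f y = f x" using \<open>f x \<in> set cs\<close> by force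
  then show "x \<in> set cs" using inj sub x by (metis inj_onD subsetD)
qed (rule is_cycle_apply_mem[OF cyc])

text \<open>A residue \<open>d\<close> is recovered from its quotient and remainder modulo
  \<open>2 ^ m\<close>, with \<open>2 ^ (n - m)\<close> possible quotients.\<close>

lemma card_residues_over_le:
  fixes A :: "nat set"
  assumes "m \<le> n" and "finite A"
  shows "card {d. d < 2 ^ n \<and> d mod 2 ^ m \<in> A} \<le> 2 ^ (n - m) * card A"
proof -
  let ?f = "\<lambda>(j, c). 2 ^ m * j + c :: nat"
  have "d \<in> ?f ` ({..<2 ^ (n - m)} \<times> A)" if "d < 2 ^ n" "d mod 2 ^ m \<in> A" for d
  proof (rule image_eqI)
    have "d < 2 ^ (n - m) * 2 ^ m" using that \<open>m \<le> n\<close> by (simp flip: power_add)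
    then show "(d div 2 ^ m, d mod 2 ^ m) \<in> {..<2 ^ (n - m)} \<times> A"
      using that by (simp add: less_mult_imp_div_less)
  qed simp
  then have "card {d. d < 2 ^ n \<and> d mod 2 ^ m \<in> A} \<le> card ({..<2 ^ (n - m) :: nat} \<times> A)"
    using assms by (intro surj_card_le) auto
  then show ?thesis by (simp add: card_cartesian_product)
qed

text \<open>\<open>Q_mod n\<close> reduces to \<open>Q_mod m\<close>, which preserves both
  \<open>C\<close> and its complement, so lying over \<open>C\<close> is constant along
  \<open>D\<close>. It holds at an entry of \<open>C\<close>, hence on all of \<open>D\<close>, and
  the prescribed length of \<open>D\<close> already equals the largest possible number of residues
  over \<open>C\<close>.\<close>

lemma ever_doubling_period_cycle:
  assumes cyc: "is_cycle (Q_mod m) {..<2 ^ m} C" and len: "length C = 2 ^ k"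
    and edp: "ever_doubling_period m k C" and mn: "m \<le> n"
  obtains D where "is_cycle (Q_mod n) {..<2 ^ n} D"
    and "set D = {d. d < 2 ^ n \<and> d mod 2 ^ m \<in> set C}"
proof -
  obtain D where D: "is_cycle (Q_mod n) {..<2 ^ n} D" "length D = 2 ^ (n - m + k)" "set C \<subseteq> set D"
    using edp mn by (auto simp: ever_doubling_period_def)
  obtain c where c: "c \<in> set C" using cyc by (metis is_cycle_def last_in_set)
  then have "c < 2 ^ m" using cyc by (auto simp: is_cycle_def)
  have "(d mod 2 ^ m \<in> set C) = (c mod 2 ^ m \<in> set C)" if "d \<in> set D" for d
  proof (rule is_cycle_constant[OF D(1), where g = "\<lambda>d. d mod 2 ^ m \<in> set C"])
    show "(Q_mod n x mod 2 ^ m \<in> set C) = (x mod 2 ^ m \<in> set C)" for x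
      by (simp add: Q_mod_mod[OF mn] is_cycle_apply_mem_iff[OF cyc inj_on_Q_mod])
  qed (use that c D(3) in auto)
  then have "set D \<subseteq> {d. d < 2 ^ n \<and> d mod 2 ^ m \<in> set C}"
    using D(1) c \<open>c < 2 ^ m\<close> by (auto simp: is_cycle_def)
  moreover have "card (set D) = 2 ^ (n - m) * card (set C)"
    using D(1,2) cyc len by (simp add: is_cycle_def distinct_card power_add)
  ultimately have "set D = {d. d < 2 ^ n \<and> d mod 2 ^ m \<in> set C}"
    using card_residues_over_le[OF mn, of "set C"] by (intro card_seteq) auto
  with D(1) show ?thesis by (rule that)
qed

section \<open>Haar measure\<close>

lemma sets_haar [measurable_cong]: "sets haar = sets borel"
  using normalized_haar_haar by (simp add: normalized_haar_def)

lemma space_haar [simp]: "space haar = UNIV"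
  using sets_eq_imp_space_eq[OF sets_haar] by simp

interpretation haar: prob_space haar
  using normalized_haar_haar by (intro prob_spaceI) (simp add: normalized_haar_def)

lemma measurable_Q [measurable]: "Q \<in> borel \<rightarrow>\<^sub>M borel"
proof (rule measurable_sigma_sets[OF borel_eq_sigma_adic_balls])
  fix A :: "two_adic set" assume "A \<in> {adic_ball y n | y n. True}"
  then obtain y n where "A = adic_ball y n" by blast
  moreover obtain z where "Q -` adic_ball y n = adic_ball z n" using ex_Q_vimage_adic_ball by blast
  ultimately show "Q -` A \<inter> space borel \<in> sets borel" by simp
qed auto

lemma measurable_Q_haar: "Q \<in> haar \<rightarrow>\<^sub>M haar"
  by measurable

text \<open>Preimages of balls under \<open>Q\<close> are balls of the same radius, and a finite
  Borel measure is determined by its values on balls.\<close>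

lemma distr_haar_Q: "distr haar haar Q = haar"
proof (rule two_adic_measure_eqI)
  show "emeasure (distr haar haar Q) (adic_ball y n) = emeasure haar (adic_ball y n)" for y n
  proof -
    obtain z where "Q -` adic_ball y n = adic_ball z n" using ex_Q_vimage_adic_ball by blast
    then show ?thesis
      by (simp add: emeasure_distr sets_haar normalized_haar_emeasure_adic_ball[OF normalized_haar_haar])
  qed
  have "prob_space (distr haar haar Q)" by (intro haar.prob_space_distr measurable_Q_haar)
  then show "emeasure (distr haar haar Q) UNIV \<noteq> \<infinity>"
    using prob_space.emeasure_space_1 by fastforce
qed (simp_all add: sets_haar)

lemma emeasure_haar_Q_vimage: "A \<in> sets borel \<Longrightarrow> emeasure haar (Q -` A) = emeasure haar A"
  using emeasure_distr[OF measurable_Q_haar, of A] by (simp add: distr_haar_Q sets_haar)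

lemma measure_haar_eq_sum_adic_balls:
  assumes A: "A \<in> sets borel"
  shows "measure haar A = (\<Sum>r<2 ^ n. measure haar (A \<inter> adic_ball (of_nat r) n))"
proof -
  have "A = (\<Union>r\<in>{..<2 ^ n}. A \<inter> adic_ball (of_nat r) n)"
    using adic_balls_cover[of n] by blast
  then have "measure haar A = measure haar (\<Union>r\<in>{..<2 ^ n}. A \<inter> adic_ball (of_nat r) n)"
    by simp
  also have "\<dots> = (\<Sum>r<2 ^ n. measure haar (A \<inter> adic_ball (of_nat r) n))"
    using A adic_balls_disjoint[of n]
    by (intro haar.finite_measure_finite_Union) (auto simp: sets_haar disjoint_family_on_def)
  finally show ?thesis .
qed

lemma haar_proportional_of_adic_balls:
  assumes [measurable]: "E \<in> sets borel" "X \<in> sets borel" "A \<in> sets borel"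
    and ball: "\<And>n r. m \<le> n \<Longrightarrow> r < 2 ^ n \<Longrightarrow>
      measure haar X * measure haar (E \<inter> adic_ball (of_nat r) n) =
      measure haar E * measure haar (X \<inter> adic_ball (of_nat r) n)"
  shows "measure haar X * measure haar (E \<inter> A) = measure haar E * measure haar (X \<inter> A)"
proof -
  \<comment> \<open>\<open>?\<nu> E X\<close> is the measure giving \<open>A\<close> the mass
    \<open>measure haar X * measure haar (E \<inter> A)\<close>. Swapping its arguments gives the
    other side of the claim, so uniqueness of measures with given values on balls applies.\<close>
  let ?\<nu> = "\<lambda>E X. scale_measure (emeasure haar X) (density haar (indicator E))"
  have \<nu>: "emeasure (?\<nu> E X) A = ennreal (measure haar X * measure haar (E \<inter> A))"
    if [measurable]: "E \<in> sets borel" "A \<in> sets borel" for E X A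
    by (simp add: emeasure_restricted sets_haar haar.emeasure_eq_measure ennreal_mult)
  have "?\<nu> E X = ?\<nu> X E"
  proof (rule two_adic_measure_eqI)
    fix y n
    \<comment> \<open>The hypothesis covers only levels from \<open>m\<close> on, so a larger ball
      is cut into balls of level \<open>?N\<close>; each of these lies inside it or misses
      it.\<close>
    let ?N = "max n m"
    have "measure haar X * measure haar (E \<inter> adic_ball y n \<inter> adic_ball (of_nat r) ?N) =
          measure haar E * measure haar (X \<inter> adic_ball y n \<inter> adic_ball (of_nat r) ?N)" if "r < 2 ^ ?N" for r
    proof -
      have "adic_ball (of_nat r) ?N \<subseteq> adic_ball (of_nat r) n"
        unfolding adic_ball_altdef using mod_pow2_eq_mono[OF _ max.cobounded1] by blast
      moreover have "adic_ball y n \<inter> adic_ball (of_nat r) n = {} \<or> adic_ball y n = adic_ball (of_nat r) n"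
        by (auto simp: adic_ball_altdef)
      ultimately have "adic_ball y n \<inter> adic_ball (of_nat r) ?N = {} \<or>
            adic_ball y n \<inter> adic_ball (of_nat r) ?N = adic_ball (of_nat r) ?N"
        by blast
      then show ?thesis
      proof
        assume "adic_ball y n \<inter> adic_ball (of_nat r) ?N = {}"
        then show ?thesis by (simp only: Int_assoc Int_empty_right measure_empty mult_zero_right)
      next
        assume "adic_ball y n \<inter> adic_ball (of_nat r) ?N = adic_ball (of_nat r) ?N"
        then show ?thesis using ball[of ?N r] that by (simp only: Int_assoc max.cobounded2)
      qed
    qed
    then have "measure haar X * measure haar (E \<inter> adic_ball y n) = measure haar E * measure haar (X \<inter> adic_ball y n)"
      using measure_haar_eq_sum_adic_balls[of "E \<inter> adic_ball y n" ?N]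
        measure_haar_eq_sum_adic_balls[of "X \<inter> adic_ball y n" ?N]
      by (simp add: sum_distrib_left)
    then show "emeasure (?\<nu> E X) (adic_ball y n) = emeasure (?\<nu> X E) (adic_ball y n)"
      by (simp add: \<nu> del: emeasure_scale_measure)
  qed (simp_all add: sets_haar \<nu> del: emeasure_scale_measure)
  then have "ennreal (measure haar X * measure haar (E \<inter> A)) = ennreal (measure haar E * measure haar (X \<inter> A))"
    using \<nu>[of E A X] \<nu>[of X A E] assms(1-3) by (simp only:)
  then show ?thesis by (simp add: ennreal_inj)
qed

text \<open>The preimage under \<open>Q\<close> of the part of \<open>E\<close> over
  \<open>Q_mod n d\<close> is the part of \<open>E\<close> over \<open>d\<close>. As
  \<open>Q\<close> preserves \<open>haar\<close>, all parts over the cycle \<open>D\<close> have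
  equal measure, and together they make up \<open>E\<close>.\<close>

lemma measure_invariant_Int_adic_ball:
  assumes E: "E \<in> sets borel" and inv: "Q -` E = E" and sub: "\<And>x. x \<in> E \<Longrightarrow> residue n x \<in> set D"
    and D: "is_cycle (Q_mod n) {..<2 ^ n} D" and r: "r \<in> set D"
  shows "measure haar E = length D * measure haar (E \<inter> adic_ball (of_nat r) n)"
proof -
  let ?g = "\<lambda>r. measure haar (E \<inter> adic_ball (of_nat r) n)"
  have Dsub: "set D \<subseteq> {..<2 ^ n}" and dist: "distinct D" using D by (auto simp: is_cycle_def)
  have g: "?g (Q_mod n d) = ?g d" for d
  proof -
    have "adic_ball (of_nat (Q_mod n d)) n = adic_ball (Q (of_nat d)) n"
      using Q_mod_less[of n d]
      by (simp add: set_eq_iff mem_adic_ball_iff_residue residue_of_nat) (simp add: Q_mod_def residue_def)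
    then have "Q -` (E \<inter> adic_ball (of_nat (Q_mod n d)) n) = E \<inter> adic_ball (of_nat d) n"
      using inv by (simp add: vimage_Int Q_vimage_adic_ball)
    then show ?thesis
      using emeasure_haar_Q_vimage[of "E \<inter> adic_ball (of_nat (Q_mod n d)) n"] E
      by (simp add: measure_def)
  qed
  have "measure haar E = (\<Sum>d<2 ^ n. ?g d)" by (rule measure_haar_eq_sum_adic_balls[OF E])
  also have "\<dots> = (\<Sum>d\<in>set D. ?g d)"
  proof (rule sum.mono_neutral_right)
    show "\<forall>d\<in>{..<2 ^ n} - set D. ?g d = 0"
    proof
      fix d assume "d \<in> {..<2 ^ n} - set D"
      then have "E \<inter> adic_ball (of_nat d) n = {}"
        using sub by (fastforce simp: mem_adic_ball_iff_residue residue_of_nat)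
      then show "?g d = 0" by simp
    qed
  qed (use Dsub in auto)
  also have "\<dots> = (\<Sum>d\<in>set D. ?g r)"
    by (rule sum.cong[OF refl]) (rule is_cycle_constant[OF D, where g = ?g, OF g _ r])
  also have "\<dots> = length D * ?g r" using dist by (simp add: distinct_card)
  finally show ?thesis .
qed

section \<open>Ergodicity\<close>

theorem theorem5:
  fixes m k :: nat and C :: "nat list"
  assumes "k \<le> m"
    and "is_cycle (Q_mod m) {..<2 ^ m} C"
    and "length C = 2 ^ k"
    and "ever_doubling_period m k C"
  shows "ergodic (restrict_space haar (\<Union>c\<in>set C. adic_ball (of_nat c) m)) Q"
proof -
  define X where "X = (\<Union>c\<in>set C. adic_ball (of_nat c) m)"
  have CS: "set C \<subseteq> {..<2 ^ m}" using assms(2) by (simp add: is_cycle_def)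
  then have "residue m (of_nat c) = c" if "c \<in> set C" for c
    using that by (auto simp: residue_of_nat)
  then have X_iff: "x \<in> X \<longleftrightarrow> residue m x \<in> set C" for x
    by (auto simp: X_def mem_adic_ball_iff_residue)
  have QX: "Q -` X = X"
    using is_cycle_apply_mem_iff[OF assms(2) inj_on_Q_mod]
    by (simp add: set_eq_iff X_iff residue_Q residue_less)
  have X [measurable]: "X \<in> sets borel" unfolding X_def by simp
  let ?R = "restrict_space haar X"
  have spR: "space ?R = X" by (simp add: space_restrict_space)
  have sR: "E \<in> sets ?R \<longleftrightarrow> E \<subseteq> X \<and> E \<in> sets borel" for E
    using X by (simp add: sets_restrict_space_iff sets_haar)
  have eR: "emeasure ?R E = emeasure haar E" if "E \<subseteq> X" for E
    using that X by (intro emeasure_restrict_space) (simp_all add: sets_haar)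
  have meas: "Q \<in> ?R \<rightarrow>\<^sub>M ?R"
    using QX by (intro measurable_restrict_space3 measurable_Q_haar) auto
  have "distr ?R ?R Q = ?R"
  proof (rule measure_eqI)
    fix E assume "E \<in> sets (distr ?R ?R Q)"
    then have E: "E \<in> sets ?R" by simp
    then have "Q -` E \<subseteq> X" using QX sR by blast
    then have "emeasure (distr ?R ?R Q) E = emeasure haar (Q -` E)"
      using emeasure_distr[OF meas E] by (simp add: spR eR Int_absorb2)
    then show "emeasure (distr ?R ?R Q) E = emeasure ?R E"
      using E by (simp add: sR eR emeasure_haar_Q_vimage)
  qed simp
  moreover have "emeasure ?R E = 0 \<or> emeasure ?R (space ?R - E) = 0"
    if E: "E \<in> sets ?R" and inv: "Q -` E \<inter> space ?R = E" for E
  proof -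
    have EX: "E \<subseteq> X" and [measurable]: "E \<in> sets borel" using E sR by auto
    \<comment> \<open>Invariance inside the restricted space becomes invariance in the whole space
      because \<open>X\<close> is its own preimage.\<close>
    have QE: "Q -` E = E" using inv QX EX spR by blast
    have "measure haar X * measure haar (E \<inter> adic_ball (of_nat r) n) =
          measure haar E * measure haar (X \<inter> adic_ball (of_nat r) n)"
      if mn: "m \<le> n" and r: "r < 2 ^ n" for n r
    proof -
      obtain D where D: "is_cycle (Q_mod n) {..<2 ^ n} D"
        and setD: "set D = {d. d < 2 ^ n \<and> d mod 2 ^ m \<in> set C}"
        using ever_doubling_period_cycle[OF assms(2-4) mn] .
      have XD: "x \<in> X \<longleftrightarrow> residue n x \<in> set D" for x
        by (simp add: X_iff setD residue_less residue_mod[OF mn])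
      show ?thesis
      \<comment> \<open>Over a residue in \<open>D\<close>, both sides equal \<open>length D\<close>
        times the product of the measures of the two parts in the ball. Any other ball misses
        \<open>X\<close>, and both sides vanish.\<close>
      proof (cases "r \<in> set D")
        case True
        have "measure haar E = length D * measure haar (E \<inter> adic_ball (of_nat r) n)"
          using EX XD by (intro measure_invariant_Int_adic_ball QE D True) auto
        moreover have "measure haar X = length D * measure haar (X \<inter> adic_ball (of_nat r) n)"
          using XD by (intro measure_invariant_Int_adic_ball QX D True) auto
        ultimately show ?thesis by simp
      next
        case False
        then have "X \<inter> adic_ball (of_nat r) n = {}"
          using r by (auto simp: XD mem_adic_ball_iff_residue residue_of_nat)
        moreover from this EX have "E \<inter> adic_ball (of_nat r) n = {}" by blast
        ultimately show ?thesis by simp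
      qed
    qed
    then have "measure haar X * measure haar (E \<inter> (X - E)) = measure haar E * measure haar (X \<inter> (X - E))"
      by (rule haar_proportional_of_adic_balls[where m = m, rotated 3]) simp_all
    then have "measure haar E = 0 \<or> measure haar (X - E) = 0"
      by (simp add: Int_absorb1 Diff_subset)
    then show ?thesis
      using EX by (simp add: eR spR haar.emeasure_eq_measure)
  qed
  ultimately show ?thesis
    using meas unfolding ergodic_def X_def by blast
qed

end
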